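(* Let $X$ be a compact Hausdorff space, let $A$ be a commutative Banach algebra, and let $\sigma:A\to A$ be a continuous algebra homomorphism with dense range. Let $\tilde{\sigma}:C(X,A)\to C(X,A)$ be the continuous homomorphism $\tilde{\sigma}(f):=\sigma\circ f$. If $A$ is $\sigma$-weakly amenable, then $C(X,A)$ is $\tilde{\sigma}$-weakly amenable.
   Context: $C(X,A)$ denotes the Banach algebra of all continuous functions $X\to A$ with pointwise operations and norm $\|f\|_\infty=\sup_{x\in X}\|f(x)\|$. Let $B$ be a Banach algebra, $\theta:B\to B$ a continuous homomorphism and $E$ a Banach $B$-bimodule. A $\theta$-derivation is a bounded linear map $D:B\to E$ with $D(ab)=D(a)\cdot\theta(b)+\theta(a)\cdot D(b)$ for all $a,b\in B$. It is $\theta$-inner if there is $x\in E$ with $D(a)=\theta(a)\cdot x-x\cdot\theta(a)$ for all $a\in B$. $B$ is $\theta$-weakly amenable if every $\theta$-derivation $D:B\to B^*$ is $\theta$-inner, where $B^*$ carries the usual dual bimodule structure. *)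

theory Defs
  imports "HOL-Analysis.Analysis"
begin

section \<open>Complex Banach algebras\<close>

text \<open>Banach algebras are complex, not assumed unital, and have a submultiplicative norm.
  The classes extend the real ones of HOL-Analysis, so real and complex scaling coexist
  on each type and are required to agree.\<close>

class scaleC =
  fixes scaleC :: "complex \<Rightarrow> 'a \<Rightarrow> 'a"  (infixr "*\<^sub>C" 75)

class complex_normed_vector = scaleC + real_normed_vector +
  assumes scaleC_add_right: "c *\<^sub>C (x + y) = c *\<^sub>C x + c *\<^sub>C y"
    and scaleC_add_left: "(c + d) *\<^sub>C x = c *\<^sub>C x + d *\<^sub>C x"
    and scaleC_scaleC: "c *\<^sub>C d *\<^sub>C x = (c * d) *\<^sub>C x"
    and scaleC_of_real: "complex_of_real r *\<^sub>C x = r *\<^sub>R x"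
    and norm_scaleC: "norm (c *\<^sub>C x) = cmod c * norm x"

class complex_banach = complex_normed_vector + complete_space
begin

subclass banach ..

end

class complex_normed_algebra = complex_normed_vector + real_normed_algebra +
  assumes mult_scaleC_left: "(c *\<^sub>C x) * y = c *\<^sub>C (x * y)"
    and mult_scaleC_right: "x * (c *\<^sub>C y) = c *\<^sub>C (x * y)"

class complex_banach_algebra = complex_normed_algebra + complete_space
begin

subclass complex_banach ..

end

instantiation complex :: complex_banach_algebra
begin

definition scaleC_complex :: "complex \<Rightarrow> complex \<Rightarrow> complex"
  where "scaleC_complex c x = c * x"

instance
  by standard (auto simp: scaleC_complex_def algebra_simps norm_mult scaleR_conv_of_real)

end

definition bounded_clinear :: "('a::complex_normed_vector \<Rightarrow> 'b::complex_normed_vector) \<Rightarrow> bool"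
  where "bounded_clinear f \<longleftrightarrow> bounded_linear f \<and> (\<forall>c x. f (c *\<^sub>C x) = c *\<^sub>C f x)"

definition continuous_algebra_hom ::
    "('a::complex_normed_algebra \<Rightarrow> 'b::complex_normed_algebra) \<Rightarrow> bool"
  where "continuous_algebra_hom h \<longleftrightarrow> bounded_clinear h \<and> (\<forall>a b. h (a * b) = h a * h b)"


section \<open>The dual space\<close>

typedef (overloaded) ('a::complex_normed_vector) cdual =
    "{f :: 'a \<Rightarrow>\<^sub>L complex. \<forall>c x. blinfun_apply f (c *\<^sub>C x) = c * blinfun_apply f x}"
  morphisms blinfun_of_cdual Cdual
  by (rule exI[of _ 0]) simp

setup_lifting type_definition_cdual

abbreviation cdual_apply :: "'a::complex_normed_vector cdual \<Rightarrow> 'a \<Rightarrow> complex"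
  where "cdual_apply f \<equiv> blinfun_apply (blinfun_of_cdual f)"

lemma cdual_apply_scaleC: "cdual_apply f (c *\<^sub>C x) = c * cdual_apply f x"
  using blinfun_of_cdual[of f] by simp

lemma cdual_eqI: "(\<And>x. cdual_apply f x = cdual_apply g x) \<Longrightarrow> f = g"
  by (simp add: blinfun_eqI blinfun_of_cdual_inject[symmetric])

lemma bounded_linear_cmult_blinfun: "bounded_linear (\<lambda>x. c * blinfun_apply f x)"
  for f :: "'a::real_normed_vector \<Rightarrow>\<^sub>L complex"
  by (intro bounded_linear_const_mult bounded_linear_blinfun_apply bounded_linear_ident)

text \<open>All operations, in particular the operator norm, are inherited from the space of
  bounded real-linear maps into the complex numbers.\<close>

instantiation cdual :: (complex_normed_vector) complex_normed_vector
begin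

lift_definition zero_cdual :: "'a cdual" is 0 by simp
lift_definition plus_cdual :: "'a cdual \<Rightarrow> 'a cdual \<Rightarrow> 'a cdual" is "(+)"
  by (simp add: blinfun.add_left algebra_simps)
lift_definition minus_cdual :: "'a cdual \<Rightarrow> 'a cdual \<Rightarrow> 'a cdual" is "(-)"
  by (simp add: blinfun.diff_left algebra_simps)
lift_definition uminus_cdual :: "'a cdual \<Rightarrow> 'a cdual" is uminus
  by (simp add: blinfun.minus_left)
lift_definition scaleR_cdual :: "real \<Rightarrow> 'a cdual \<Rightarrow> 'a cdual" is "scaleR"
  by (simp add: blinfun.scaleR_left)
lift_definition scaleC_cdual :: "complex \<Rightarrow> 'a cdual \<Rightarrow> 'a cdual"
  is "\<lambda>c f. Blinfun (\<lambda>x. c * blinfun_apply f x)"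
  by (simp add: bounded_linear_Blinfun_apply bounded_linear_cmult_blinfun)
lift_definition norm_cdual :: "'a cdual \<Rightarrow> real" is norm .
lift_definition dist_cdual :: "'a cdual \<Rightarrow> 'a cdual \<Rightarrow> real" is dist .
lift_definition sgn_cdual :: "'a cdual \<Rightarrow> 'a cdual" is sgn
  by (simp add: sgn_div_norm blinfun.scaleR_left)

definition uniformity_cdual :: "('a cdual \<times> 'a cdual) filter"
  where "uniformity_cdual = (INF e\<in>{0 <..}. principal {(x, y). dist x y < e})"

definition open_cdual :: "'a cdual set \<Rightarrow> bool"
  where "open_cdual S = (\<forall>x\<in>S. \<forall>\<^sub>F (x', y) in uniformity. x' = x \<longrightarrow> y \<in> S)"

instance
proof
  fix f g h :: "'a cdual" and r s :: real and c d :: complex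
  show "f + g + h = f + (g + h)" by transfer simp
  show "f + g = g + f" by transfer simp
  show "0 + f = f" by transfer simp
  show "- f + f = 0" by transfer simp
  show "f - g = f + - g" by transfer simp
  show "r *\<^sub>R (f + g) = r *\<^sub>R f + r *\<^sub>R g" by transfer (simp add: scaleR_add_right)
  show "(r + s) *\<^sub>R f = r *\<^sub>R f + s *\<^sub>R f" by transfer (simp add: scaleR_add_left)
  show "r *\<^sub>R s *\<^sub>R f = (r * s) *\<^sub>R f" by transfer simp
  show "1 *\<^sub>R f = f" by transfer simp
  show "sgn f = inverse (norm f) *\<^sub>R f" by transfer (simp add: sgn_div_norm)
  show "dist f g = norm (f - g)" by transfer (simp add: dist_norm)
  show "(norm f = 0) = (f = 0)" by transfer simp
  show "norm (f + g) \<le> norm f + norm g" by transfer (rule norm_triangle_ineq)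
  show "norm (r *\<^sub>R f) = \<bar>r\<bar> * norm f" by transfer simp
  note ap = bounded_linear_Blinfun_apply[OF bounded_linear_cmult_blinfun]
  have apC: "cdual_apply (c *\<^sub>C k) x = c * cdual_apply k x" for c x and k :: "'a cdual"
    by (simp add: scaleC_cdual.rep_eq ap)
  show "c *\<^sub>C (f + g) = c *\<^sub>C f + c *\<^sub>C g"
    by (rule cdual_eqI) (simp add: apC plus_cdual.rep_eq blinfun.add_left distrib_left)
  show "(c + d) *\<^sub>C f = c *\<^sub>C f + d *\<^sub>C f"
    by (rule cdual_eqI) (simp add: apC plus_cdual.rep_eq blinfun.add_left distrib_right)
  show "c *\<^sub>C d *\<^sub>C f = (c * d) *\<^sub>C f"
    by (rule cdual_eqI) (simp add: apC mult.assoc)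
  show "complex_of_real r *\<^sub>C f = r *\<^sub>R f"
    by transfer (auto intro!: blinfun_eqI simp: ap blinfun.scaleR_left scaleR_conv_of_real)
  show "norm (c *\<^sub>C f) = cmod c * norm f"
  proof transfer
    fix c and f :: "'a \<Rightarrow>\<^sub>L complex"
    have le: "norm (Blinfun (\<lambda>x. c * blinfun_apply f x)) \<le> cmod c * norm f"
      for c and f :: "'a \<Rightarrow>\<^sub>L complex"
    proof (rule norm_blinfun_bound)
      show "norm (blinfun_apply (Blinfun (\<lambda>x. c * blinfun_apply f x)) x)
          \<le> cmod c * norm f * norm x" for x
        using mult_left_mono[OF norm_blinfun[of f x], of "cmod c"]
        by (simp add: ap norm_mult mult.assoc)
    qed simp
    show "norm (Blinfun (\<lambda>x. c * blinfun_apply f x)) = cmod c * norm f"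
    proof (cases "c = 0")
      case True
      then show ?thesis using le[of c f] by simp
    next
      case False
      have "Blinfun (\<lambda>x. inverse c * blinfun_apply (Blinfun (\<lambda>x. c * blinfun_apply f x)) x) = f"
        by (rule blinfun_eqI) (simp add: ap False blinfun_apply_inverse flip: mult.assoc)
      then have "norm f \<le> cmod (inverse c) * norm (Blinfun (\<lambda>x. c * blinfun_apply f x))"
        using le[of "inverse c" "Blinfun (\<lambda>x. c * blinfun_apply f x)"] by simp
      then have "cmod c * norm f \<le> norm (Blinfun (\<lambda>x. c * blinfun_apply f x))"
        using False by (simp add: norm_divide field_simps)
      then show ?thesis using le[of c f] by simp
    qed
  qed
qed (rule uniformity_cdual_def open_cdual_def)+

end

instance cdual :: (complex_normed_vector) complex_banach
proof
  fix F :: "nat \<Rightarrow> 'a cdual"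
  assume "Cauchy F"
  then have "Cauchy (\<lambda>n. blinfun_of_cdual (F n))"
    by (simp add: Cauchy_def dist_cdual.rep_eq)
  then obtain l where l: "(\<lambda>n. blinfun_of_cdual (F n)) \<longlonglongrightarrow> l"
    using Cauchy_convergent convergent_def by blast
  have lim: "(\<lambda>n. cdual_apply (F n) x) \<longlonglongrightarrow> blinfun_apply l x" for x
    by (intro tendsto_intros l)
  have "blinfun_apply l (c *\<^sub>C x) = c * blinfun_apply l x" for c x
  proof (rule LIMSEQ_unique)
    show "(\<lambda>n. cdual_apply (F n) (c *\<^sub>C x)) \<longlonglongrightarrow> blinfun_apply l (c *\<^sub>C x)" by (rule lim)
    show "(\<lambda>n. cdual_apply (F n) (c *\<^sub>C x)) \<longlonglongrightarrow> c * blinfun_apply l x"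
      unfolding cdual_apply_scaleC by (intro tendsto_intros lim)
  qed
  then have "blinfun_of_cdual (Cdual l) = l" by (simp add: Cdual_inverse)
  then have "F \<longlonglongrightarrow> Cdual l"
    using l by (simp add: tendsto_iff dist_cdual.rep_eq)
  then show "convergent F" by (rule convergentI)
qed


section \<open>Bimodules and \<open>\<theta>\<close>-derivations\<close>

locale banach_bimodule =
  fixes lact :: "'b::complex_banach_algebra \<Rightarrow> 'e::complex_banach \<Rightarrow> 'e"
    and ract :: "'e \<Rightarrow> 'b \<Rightarrow> 'e"
  assumes bounded_bilinear_lact: "bounded_bilinear lact"
    and bounded_bilinear_ract: "bounded_bilinear ract"
    and lact_scaleC_left: "lact (c *\<^sub>C a) x = c *\<^sub>C lact a x"
    and lact_scaleC_right: "lact a (c *\<^sub>C x) = c *\<^sub>C lact a x"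
    and ract_scaleC_left: "ract (c *\<^sub>C x) a = c *\<^sub>C ract x a"
    and ract_scaleC_right: "ract x (c *\<^sub>C a) = c *\<^sub>C ract x a"
    and lact_assoc: "lact (a * b) x = lact a (lact b x)"
    and ract_assoc: "ract x (a * b) = ract (ract x a) b"
    and lact_ract: "ract (lact a x) b = lact a (ract x b)"
begin

definition derivation :: "('b \<Rightarrow> 'b) \<Rightarrow> ('b \<Rightarrow> 'e) \<Rightarrow> bool"
  where "derivation \<theta> D \<longleftrightarrow> bounded_clinear D \<and>
    (\<forall>a b. D (a * b) = ract (D a) (\<theta> b) + lact (\<theta> a) (D b))"

definition inner_derivation :: "('b \<Rightarrow> 'b) \<Rightarrow> ('b \<Rightarrow> 'e) \<Rightarrow> bool"
  where "inner_derivation \<theta> D \<longleftrightarrow> (\<exists>x. \<forall>a. D a = lact (\<theta> a) x - ract x (\<theta> a))"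

end

lift_definition cdual_lact :: "'b::complex_normed_algebra \<Rightarrow> 'b cdual \<Rightarrow> 'b cdual"
  is "\<lambda>a f. Blinfun (\<lambda>x. blinfun_apply f (x * a))"
  by (subst (1 2) bounded_linear_Blinfun_apply)
    (auto intro!: bounded_linear_intros simp: mult_scaleC_left)

lift_definition cdual_ract :: "'b::complex_normed_algebra cdual \<Rightarrow> 'b \<Rightarrow> 'b cdual"
  is "\<lambda>f a. Blinfun (\<lambda>x. blinfun_apply f (a * x))"
  by (subst (1 2) bounded_linear_Blinfun_apply)
    (auto intro!: bounded_linear_intros simp: mult_scaleC_right)

lemma cdual_lact_apply: "cdual_apply (cdual_lact a f) x = cdual_apply f (x * a)"
  by transfer (subst bounded_linear_Blinfun_apply, auto intro!: bounded_linear_intros)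

lemma cdual_ract_apply: "cdual_apply (cdual_ract f a) x = cdual_apply f (a * x)"
  by transfer (subst bounded_linear_Blinfun_apply, auto intro!: bounded_linear_intros)

lemma cdual_apply_simps:
  "cdual_apply (f + g) x = cdual_apply f x + cdual_apply g x"
  "cdual_apply (f - g) x = cdual_apply f x - cdual_apply g x"
  "cdual_apply 0 x = 0"
  "cdual_apply (r *\<^sub>R f) x = r *\<^sub>R cdual_apply f x"
  "cdual_apply (c *\<^sub>C f) x = c * cdual_apply f x"
  by (simp_all add: plus_cdual.rep_eq minus_cdual.rep_eq zero_cdual.rep_eq scaleR_cdual.rep_eq
      scaleC_cdual.rep_eq blinfun.add_left blinfun.diff_left blinfun.scaleR_left
      bounded_linear_Blinfun_apply bounded_linear_cmult_blinfun)

lemma norm_cdual_bound: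
  assumes "0 \<le> b" "\<And>x. norm (cdual_apply f x) \<le> b * norm x"
  shows "norm f \<le> b"
  unfolding norm_cdual.rep_eq using assms by (rule norm_blinfun_bound)

lemma norm_cdual: "norm (cdual_apply f x) \<le> norm f * norm x"
  unfolding norm_cdual.rep_eq by (rule norm_blinfun)

interpretation cdual: banach_bimodule
  "cdual_lact :: 'b::complex_banach_algebra \<Rightarrow> _" cdual_ract
proof
  note s = cdual_lact_apply cdual_ract_apply cdual_apply_simps cdual_apply_scaleC
    mult_scaleC_left mult_scaleC_right blinfun.add_right blinfun.scaleR_right algebra_simps
  fix a b :: 'b and f g :: "'b cdual" and r :: real and c :: complex
  show "cdual_lact (a + b) f = cdual_lact a f + cdual_lact b f" by (rule cdual_eqI) (simp add: s)
  show "cdual_lact a (f + g) = cdual_lact a f + cdual_lact a g" by (rule cdual_eqI) (simp add: s)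
  show "cdual_lact (r *\<^sub>R a) f = r *\<^sub>R cdual_lact a f" by (rule cdual_eqI) (simp add: s)
  show "cdual_lact a (r *\<^sub>R f) = r *\<^sub>R cdual_lact a f" by (rule cdual_eqI) (simp add: s)
  show "cdual_ract (f + g) a = cdual_ract f a + cdual_ract g a" by (rule cdual_eqI) (simp add: s)
  show "cdual_ract f (a + b) = cdual_ract f a + cdual_ract f b" by (rule cdual_eqI) (simp add: s)
  show "cdual_ract (r *\<^sub>R f) a = r *\<^sub>R cdual_ract f a" by (rule cdual_eqI) (simp add: s)
  show "cdual_ract f (r *\<^sub>R a) = r *\<^sub>R cdual_ract f a" by (rule cdual_eqI) (simp add: s)
  show "cdual_lact (c *\<^sub>C a) f = c *\<^sub>C cdual_lact a f" by (rule cdual_eqI) (simp add: s)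
  show "cdual_lact a (c *\<^sub>C f) = c *\<^sub>C cdual_lact a f" by (rule cdual_eqI) (simp add: s)
  show "cdual_ract (c *\<^sub>C f) a = c *\<^sub>C cdual_ract f a" by (rule cdual_eqI) (simp add: s)
  show "cdual_ract f (c *\<^sub>C a) = c *\<^sub>C cdual_ract f a" by (rule cdual_eqI) (simp add: s)
  show "cdual_lact (a * b) f = cdual_lact a (cdual_lact b f)"
    by (rule cdual_eqI) (simp add: cdual_lact_apply mult.assoc)
  show "cdual_ract f (a * b) = cdual_ract (cdual_ract f a) b"
    by (rule cdual_eqI) (simp add: cdual_ract_apply mult.assoc)
  show "cdual_ract (cdual_lact a f) b = cdual_lact a (cdual_ract f b)"
    by (rule cdual_eqI) (simp add: cdual_lact_apply cdual_ract_apply mult.assoc)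
next
  have "norm (cdual_lact a f) \<le> norm a * norm f * 1" for a :: 'b and f
  proof (rule norm_cdual_bound)
    show "norm (cdual_apply (cdual_lact a f) x) \<le> norm a * norm f * 1 * norm x" for x
      unfolding cdual_lact_apply
      using norm_cdual[of f "x * a"] mult_left_mono[OF norm_mult_ineq[of x a], of "norm f"]
      by (simp add: mult_ac)
  qed simp
  then show "\<exists>K. \<forall>(a::'b) f. norm (cdual_lact a f) \<le> norm a * norm f * K" by blast
  have "norm (cdual_ract f a) \<le> norm f * norm a * 1" for a :: 'b and f
  proof (rule norm_cdual_bound)
    show "norm (cdual_apply (cdual_ract f a) x) \<le> norm f * norm a * 1 * norm x" for x
      unfolding cdual_ract_apply
      using norm_cdual[of f "a * x"] mult_left_mono[OF norm_mult_ineq[of a x], of "norm f"]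
      by (simp add: mult_ac)
  qed simp
  then show "\<exists>K. \<forall>f (a::'b). norm (cdual_ract f a) \<le> norm f * norm a * K" by blast
qed

definition weakly_amenable :: "('b::complex_banach_algebra \<Rightarrow> 'b) \<Rightarrow> bool"
  where "weakly_amenable \<theta> \<longleftrightarrow>
    (\<forall>D :: 'b \<Rightarrow> 'b cdual. cdual.derivation \<theta> D \<longrightarrow> cdual.inner_derivation \<theta> D)"


section \<open>The algebra of continuous functions\<close>

text \<open>For compact \<open>X\<close> every continuous function on \<open>X\<close> is bounded, so the library type
  of bounded continuous functions with the supremum norm is \<open>C(X, A)\<close>.\<close>

lemma mult_cont: "f \<in> bcontfun \<Longrightarrow> g \<in> bcontfun \<Longrightarrow> (\<lambda>x. f x * g x) \<in> bcontfun"
  for f g :: "'x::topological_space \<Rightarrow> 'a::real_normed_algebra"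
proof -
  assume f: "f \<in> bcontfun" and g: "g \<in> bcontfun"
  then obtain b c where b: "\<And>x. norm (f x) \<le> b" and c: "\<And>x. norm (g x) \<le> c"
    unfolding bcontfun_def bounded_iff by auto
  have "0 \<le> b" using b[of undefined] norm_ge_zero order_trans by blast
  then have "norm (f x * g x) \<le> b * c" for x
    by (rule order_trans[OF norm_mult_ineq mult_mono[OF b c]]) simp
  then show ?thesis
    using f g by (intro bcontfun_normI) (auto simp: bcontfun_def intro!: continuous_intros)
qed

lemma bounded_clinear_comp_cont: "bounded_clinear h \<Longrightarrow> f \<in> bcontfun \<Longrightarrow> h \<circ> f \<in> bcontfun"
  for f :: "'x::topological_space \<Rightarrow> 'a::complex_normed_vector"
proof -
  assume h: "bounded_clinear h" and f: "f \<in> bcontfun"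
  then have lin: "bounded_linear h" by (simp add: bounded_clinear_def)
  have "continuous_on UNIV (\<lambda>x. h (f x))"
    using f by (intro bounded_linear.continuous_on[OF lin]) (simp add: bcontfun_def)
  moreover have "bounded (h ` range f)"
    using f by (intro bounded_linear_image lin) (simp add: bcontfun_def)
  ultimately show ?thesis by (simp add: bcontfun_def o_def image_image)
qed

lemma scaleC_cont: "f \<in> bcontfun \<Longrightarrow> (\<lambda>x. c *\<^sub>C f x) \<in> bcontfun"
  for f :: "'x::topological_space \<Rightarrow> 'a::complex_normed_vector"
proof -
  have "bounded_linear (\<lambda>x::'a. c *\<^sub>C x)"
  proof (rule bounded_linear_intro)
    show "c *\<^sub>C (r *\<^sub>R x) = r *\<^sub>R (c *\<^sub>C x)" for r and x :: 'a
      by (simp add: scaleC_scaleC mult.commute flip: scaleC_of_real)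
    show "norm (c *\<^sub>C x) \<le> norm x * cmod c" for x :: 'a
      by (simp add: norm_scaleC)
  qed (rule scaleC_add_right)
  then have "bounded_clinear (\<lambda>x::'a. c *\<^sub>C x)"
    by (simp add: bounded_clinear_def scaleC_scaleC mult.commute)
  then show "f \<in> bcontfun \<Longrightarrow> (\<lambda>x. c *\<^sub>C f x) \<in> bcontfun"
    by (drule_tac bounded_clinear_comp_cont) (simp_all add: o_def)
qed

instantiation bcontfun :: (topological_space, complex_normed_vector) complex_normed_vector
begin

definition scaleC_bcontfun :: "complex \<Rightarrow> ('a \<Rightarrow>\<^sub>C 'b) \<Rightarrow> 'a \<Rightarrow>\<^sub>C 'b"
  where "scaleC_bcontfun c f = Bcontfun (\<lambda>x. c *\<^sub>C apply_bcontfun f x)"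

lemma scaleC_bcontfun_apply [simp]:
  "apply_bcontfun (c *\<^sub>C f) x = c *\<^sub>C apply_bcontfun f x" for f :: "'a \<Rightarrow>\<^sub>C 'b"
  unfolding scaleC_bcontfun_def
  by (simp add: Bcontfun_inverse[OF scaleC_cont[OF apply_bcontfun]])

instance
proof
  fix f g :: "'a \<Rightarrow>\<^sub>C 'b" and c d :: complex and r :: real
  show "c *\<^sub>C (f + g) = c *\<^sub>C f + c *\<^sub>C g"
    by (rule bcontfun_eqI) (simp add: scaleC_add_right)
  show "(c + d) *\<^sub>C f = c *\<^sub>C f + d *\<^sub>C f"
    by (rule bcontfun_eqI) (simp add: scaleC_add_left)
  show "c *\<^sub>C d *\<^sub>C f = (c * d) *\<^sub>C f"
    by (rule bcontfun_eqI) (simp add: scaleC_scaleC)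
  show "complex_of_real r *\<^sub>C f = r *\<^sub>R f"
    by (rule bcontfun_eqI) (simp add: scaleC_of_real)
  have le: "norm (c *\<^sub>C f) \<le> cmod c * norm f" for c and f :: "'a \<Rightarrow>\<^sub>C 'b"
    by (rule norm_bound) (simp add: norm_scaleC mult_left_mono norm_bounded)
  show "norm (c *\<^sub>C f) = cmod c * norm f"
  proof (cases "c = 0")
    case True
    then show ?thesis using le[of c f] by simp
  next
    case False
    have "inverse c *\<^sub>C c *\<^sub>C f = f"
      using False scaleC_of_real[of 1]
      by (intro bcontfun_eqI) (simp add: scaleC_scaleC)
    then have "norm f \<le> cmod (inverse c) * norm (c *\<^sub>C f)"
      using le[of "inverse c" "c *\<^sub>C f"] by simp
    then have "cmod c * norm f \<le> norm (c *\<^sub>C f)"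
      using False by (simp add: norm_divide field_simps)
    then show ?thesis using le[of c f] by simp
  qed
qed

end

instantiation bcontfun :: (topological_space, complex_normed_algebra) complex_normed_algebra
begin

definition times_bcontfun :: "('a \<Rightarrow>\<^sub>C 'b) \<Rightarrow> ('a \<Rightarrow>\<^sub>C 'b) \<Rightarrow> 'a \<Rightarrow>\<^sub>C 'b"
  where "times_bcontfun f g = Bcontfun (\<lambda>x. apply_bcontfun f x * apply_bcontfun g x)"

lemma times_bcontfun_apply [simp]:
  "apply_bcontfun (f * g) x = apply_bcontfun f x * apply_bcontfun g x" for f g :: "'a \<Rightarrow>\<^sub>C 'b"
  unfolding times_bcontfun_def
  by (simp add: Bcontfun_inverse[OF mult_cont[OF apply_bcontfun apply_bcontfun]])

instance
proof
  fix f g h :: "'a \<Rightarrow>\<^sub>C 'b" and c :: complex and r :: real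
  show "f * g * h = f * (g * h)" by (rule bcontfun_eqI) (simp add: mult.assoc)
  show "(f + g) * h = f * h + g * h" by (rule bcontfun_eqI) (simp add: distrib_right)
  show "f * (g + h) = f * g + f * h" by (rule bcontfun_eqI) (simp add: distrib_left)
  show "r *\<^sub>R f * g = r *\<^sub>R (f * g)" by (rule bcontfun_eqI) simp
  show "f * r *\<^sub>R g = r *\<^sub>R (f * g)" by (rule bcontfun_eqI) simp
  show "c *\<^sub>C f * g = c *\<^sub>C (f * g)" by (rule bcontfun_eqI) (simp add: mult_scaleC_left)
  show "f * c *\<^sub>C g = c *\<^sub>C (f * g)" by (rule bcontfun_eqI) (simp add: mult_scaleC_right)
  show "norm (f * g) \<le> norm f * norm g"
    by (rule norm_bound)
      (auto intro!: order_trans[OF norm_mult_ineq] mult_mono norm_bounded)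
qed

end

text \<open>The library proves completeness only for metric domains; the proof works verbatim
  for topological ones.\<close>

instance bcontfun :: (topological_space, complete_space) complete_space
proof
  fix f :: "nat \<Rightarrow> ('a, 'b) bcontfun"
  assume "Cauchy f"
  then obtain g where "uniform_limit UNIV f g sequentially"
    using uniformly_convergent_eq_cauchy[of "\<lambda>_. True" f]
    unfolding Cauchy_def uniform_limit_sequentially_iff
    by (metis dist_fun_lt_imp_dist_val_lt)
  from uniform_limit_bcontfunE[OF this sequentially_bot]
  obtain l' where "g = apply_bcontfun l'" "(f \<longlonglongrightarrow> l')" by metis
  then show "convergent f"
    by (intro convergentI)
qed

instance bcontfun :: (topological_space, complex_banach_algebra) complex_banach_algebra ..

definition comp_bcontfun :: "('a::metric_space \<Rightarrow> 'b::metric_space) \<Rightarrow>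
    ('x::topological_space \<Rightarrow>\<^sub>C 'a) \<Rightarrow> 'x \<Rightarrow>\<^sub>C 'b"
  where "comp_bcontfun h f = Bcontfun (h \<circ> apply_bcontfun f)"

text \<open>On a compact domain \<open>h \<circ> f\<close> is bounded for every continuous \<open>h\<close>, and on any domain for every
  bounded linear \<open>h\<close>; in these cases \<^const>\<open>comp_bcontfun\<close> is composition.\<close>

lemma comp_bcontfun_apply:
  assumes "continuous_algebra_hom h"
  shows "apply_bcontfun (comp_bcontfun h f) x = h (apply_bcontfun f x)"
  using assms bounded_clinear_comp_cont[OF _ apply_bcontfun[of f], of h]
  by (simp add: comp_bcontfun_def continuous_algebra_hom_def Bcontfun_inverse)

lemma continuous_algebra_hom_comp_bcontfun:
  assumes "continuous_algebra_hom h"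
  shows "continuous_algebra_hom
    (comp_bcontfun h :: ('x::topological_space \<Rightarrow>\<^sub>C 'a::complex_normed_algebra) \<Rightarrow> _)"
proof -
  note ap = comp_bcontfun_apply[OF assms]
  have lin: "bounded_linear h" and c: "h (c *\<^sub>C a) = c *\<^sub>C h a" and m: "h (a * b) = h a * h b"
    for c a b using assms by (auto simp: continuous_algebra_hom_def bounded_clinear_def)
  interpret h: bounded_linear h by (fact lin)
  obtain K where K: "0 \<le> K" "\<And>a. norm (h a) \<le> norm a * K"
    using h.nonneg_bounded by blast
  have "bounded_linear (comp_bcontfun h :: ('x \<Rightarrow>\<^sub>C 'a) \<Rightarrow> _)"
  proof (rule bounded_linear_intro)
    show "norm (comp_bcontfun h f) \<le> norm f * K" for f :: "'x \<Rightarrow>\<^sub>C 'a"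
      by (rule norm_bound)
        (auto simp: ap intro: order_trans[OF K(2)] mult_right_mono norm_bounded K(1))
  qed (auto intro!: bcontfun_eqI simp: ap h.add h.scaleR)
  then show ?thesis
    by (auto intro!: bcontfun_eqI simp: continuous_algebra_hom_def bounded_clinear_def ap c m)
qed

end

theory Submission
  imports Defs
begin

text \<open>Inner derivations into the dual of a commutative algebra vanish, so the task is to show
  \<open>D = 0\<close> for every derivation \<open>D\<close> of \<open>C(X, A)\<close>, twisted by \<open>f \<mapsto> \<sigma> \<circ> f\<close>. A functional \<open>\<phi>\<close> on \<open>A\<close> that
  kills all products gives the \<open>\<sigma>\<close>-derivation \<open>a \<mapsto> \<phi>(a) \<phi>\<close>, so \<open>\<phi> = 0\<close>. First, \<open>D\<close> vanishes on
  constants: for fixed \<open>h\<close>, the map \<open>a \<mapsto> (b \<mapsto> D(a)(h b))\<close> is a \<open>\<sigma>\<close>-derivation of \<open>A\<close>. Hence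
  \<open>D(f a b) = \<sigma>(b) D(f a)\<close> for scalar functions \<open>f\<close>, which yields
  \<open>D(f g c) = g D(f c) + f D(g c)\<close> when \<open>c\<close> is a product, and then for all \<open>c\<close>. So
  \<open>f \<mapsto> D(f c)\<close> is a derivation of \<open>C(X)\<close> into a symmetric module and is zero: for unimodular \<open>u\<close>
  it maps \<open>u\<^sup>n\<close> to \<open>n\<close> times an isometric copy of the image of \<open>u\<close>, and unimodular functions
  span \<open>C(X)\<close>. Finally, the functions \<open>f a\<close> span a dense subspace of \<open>C(X, A)\<close>.\<close>

section \<open>Complex bilinear maps\<close>

text \<open>A map into a dual space is treated below as a bilinear form, so that both module actions
  become multiplications in the second argument.\<close>

definition bounded_cbilinear ::
    "('a::complex_normed_vector \<Rightarrow> 'b::complex_normed_vector \<Rightarrow> 'c::complex_normed_vector) \<Rightarrow> bool"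
  where "bounded_cbilinear B \<longleftrightarrow> bounded_bilinear B \<and>
    (\<forall>c x y. B (c *\<^sub>C x) y = c *\<^sub>C B x y \<and> B x (c *\<^sub>C y) = c *\<^sub>C B x y)"

lemma bounded_cbilinear_comp:
  assumes "bounded_cbilinear B" "bounded_clinear f" "bounded_clinear g"
  shows "bounded_cbilinear (\<lambda>x y. B (f x) (g y))"
  using assms by (auto simp: bounded_cbilinear_def bounded_clinear_def intro: bounded_bilinear.comp)

lemma bounded_cbilinear_left: "bounded_cbilinear B \<Longrightarrow> bounded_clinear (\<lambda>x. B x y)"
  by (auto simp: bounded_cbilinear_def bounded_clinear_def intro: bounded_bilinear.bounded_linear_left)

lemma bounded_cbilinear_right: "bounded_cbilinear B \<Longrightarrow> bounded_clinear (B x)"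
  by (auto simp: bounded_cbilinear_def bounded_clinear_def intro: bounded_bilinear.bounded_linear_right)

lemma bounded_clinear_ident: "bounded_clinear (\<lambda>x. x)"
  by (simp add: bounded_clinear_def bounded_linear_ident)

lemma bounded_clinear_compose:
  "bounded_clinear f \<Longrightarrow> bounded_clinear g \<Longrightarrow> bounded_clinear (\<lambda>x. f (g x))"
  by (auto simp: bounded_clinear_def intro: bounded_linear_compose)

lemma bounded_cbilinear_mult:
  "bounded_cbilinear ((*) :: 'a::complex_normed_algebra \<Rightarrow> 'a \<Rightarrow> 'a)"
  by (simp add: bounded_cbilinear_def bounded_bilinear_mult mult_scaleC_left mult_scaleC_right)

lemma bounded_bilinear_scaleC:
  "bounded_bilinear ((*\<^sub>C) :: complex \<Rightarrow> 'a::complex_normed_vector \<Rightarrow> 'a)"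
proof
  fix a a' :: complex and b b' :: 'a and r :: real
  show "(a + a') *\<^sub>C b = a *\<^sub>C b + a' *\<^sub>C b" by (rule scaleC_add_left)
  show "a *\<^sub>C (b + b') = a *\<^sub>C b + a *\<^sub>C b'" by (rule scaleC_add_right)
  show "(r *\<^sub>R a) *\<^sub>C b = r *\<^sub>R a *\<^sub>C b"
    by (simp add: scaleR_conv_of_real scaleC_scaleC flip: scaleC_of_real)
  show "a *\<^sub>C (r *\<^sub>R b) = r *\<^sub>R a *\<^sub>C b"
    by (simp add: scaleC_scaleC mult.commute flip: scaleC_of_real)
  show "\<exists>K. \<forall>a (b::'a). norm (a *\<^sub>C b) \<le> norm a * norm b * K"
    by (rule exI[of _ 1]) (simp add: norm_scaleC)
qed

lemma bounded_cbilinear_cdual_apply: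
  "bounded_cbilinear (cdual_apply :: 'a::complex_normed_vector cdual \<Rightarrow> 'a \<Rightarrow> complex)"
  unfolding bounded_cbilinear_def
proof (intro conjI)
  show "bounded_bilinear (cdual_apply :: 'a cdual \<Rightarrow> 'a \<Rightarrow> complex)"
    by standard
      (auto simp: cdual_apply_simps blinfun.add_right blinfun.scaleR_right
        intro!: exI[of _ 1] norm_cdual)
qed (simp add: cdual_apply_simps cdual_apply_scaleC scaleC_complex_def)

lemma bounded_clinear_cdual:
  fixes \<phi> :: "'a::complex_normed_vector \<Rightarrow> complex"
  assumes "bounded_clinear \<phi>"
  obtains f where "\<And>x. cdual_apply f x = \<phi> x"
proof
  show "cdual_apply (Cdual (Blinfun \<phi>)) x = \<phi> x" for x
    using assms
    by (subst Cdual_inverse)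
      (auto simp: bounded_clinear_def scaleC_complex_def bounded_linear_Blinfun_apply)
qed

text \<open>Currying: turns a form back into a map into the dual, where weak amenability applies. A
  bound for the form also bounds the operator norm of the map.\<close>

lemma bounded_cbilinear_cdual:
  fixes B :: "'a::complex_normed_vector \<Rightarrow> 'b::complex_normed_vector \<Rightarrow> complex"
  assumes "bounded_cbilinear B"
  obtains D where "bounded_clinear D" "\<And>a b. cdual_apply (D a) b = B a b"
proof -
  have "\<exists>f. \<forall>b. cdual_apply f b = B a b" for a
    using bounded_clinear_cdual[OF bounded_cbilinear_right[OF assms]] by metis
  then obtain D where D: "\<And>a b. cdual_apply (D a) b = B a b" by metis
  interpret B: bounded_bilinear B using assms by (simp add: bounded_cbilinear_def)
  obtain K where K: "0 \<le> K" "\<And>a b. norm (B a b) \<le> norm a * norm b * K"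
    using B.nonneg_bounded by blast
  have "bounded_linear D"
  proof (rule bounded_linear_intro)
    show "norm (D a) \<le> norm a * K" for a
      using K by (intro norm_cdual_bound) (auto simp: D mult_ac)
  qed (auto intro!: cdual_eqI simp: D cdual_apply_simps B.add_left B.scaleR_left)
  then have "bounded_clinear D"
    using assms
    by (auto intro!: cdual_eqI
        simp: bounded_clinear_def bounded_cbilinear_def D cdual_apply_simps scaleC_complex_def)
  then show ?thesis using D that by blast
qed


section \<open>Commutative weakly amenable algebras\<close>

text \<open>\<open>der\<close> is the derivation identity evaluated at \<open>c\<close>. By
  commutativity the left and right actions on the dual agree, so the commutator with any
  \<open>x\<close> is zero.\<close>

lemma weakly_amenable_bilinear_eq_0:
  fixes \<sigma> :: "'a::{complex_banach_algebra, comm_ring} \<Rightarrow> 'a" and B :: "'a \<Rightarrow> 'a \<Rightarrow> complex"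
  assumes wa: "weakly_amenable \<sigma>" and B: "bounded_cbilinear B"
    and der: "\<And>a b c. B (a * b) c = B a (\<sigma> b * c) + B b (\<sigma> a * c)"
  shows "B a b = 0"
proof -
  obtain D where D: "bounded_clinear D" "\<And>a b. cdual_apply (D a) b = B a b"
    by (rule bounded_cbilinear_cdual[OF B]) (rule that)
  have "cdual.derivation \<sigma> D"
    unfolding cdual.derivation_def
    by (intro conjI D(1) allI cdual_eqI)
      (simp add: cdual_apply_simps cdual_lact_apply cdual_ract_apply D(2) der mult.commute)
  then obtain x where "\<And>a. D a = cdual_lact (\<sigma> a) x - cdual_ract x (\<sigma> a)"
    using wa unfolding weakly_amenable_def cdual.inner_derivation_def by blast
  then have "cdual_apply (D a) b = 0"
    by (simp add: cdual_apply_simps cdual_lact_apply cdual_ract_apply mult.commute)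
  then show ?thesis by (simp add: D(2))
qed

text \<open>Serves to extend identities linear in \<open>a\<close> from products to all
  elements.\<close>

lemma weakly_amenable_functional_eq_0:
  fixes \<sigma> :: "'a::{complex_banach_algebra, comm_ring} \<Rightarrow> 'a" and \<phi> :: "'a \<Rightarrow> complex"
  assumes "weakly_amenable \<sigma>" and \<phi>: "bounded_clinear \<phi>" and 0: "\<And>a b. \<phi> (a * b) = 0"
  shows "\<phi> a = 0"
proof -
  \<comment> \<open>For the form \<open>\<phi> a * \<phi> b\<close>, every term of the derivation
    identity contains the value of \<open>\<phi>\<close> at a product.\<close>
  have "\<phi> a * \<phi> a = 0"
    using assms(1) bounded_cbilinear_comp[OF bounded_cbilinear_mult \<phi> \<phi>]
    by (rule weakly_amenable_bilinear_eq_0) (simp add: 0)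
  then show ?thesis by simp
qed


section \<open>Functions with values in a Banach space as a module over scalar functions\<close>

text \<open>The precedence lies between those of \<open>*\<close> and \<open>*\<^sub>C\<close>:
  \<open>a * p \<odot> h\<close> means \<open>a * (p \<odot> h)\<close>.\<close>

definition smult_bcontfun ::
    "('x::topological_space \<Rightarrow>\<^sub>C complex) \<Rightarrow> ('x \<Rightarrow>\<^sub>C 'a::complex_normed_vector) \<Rightarrow> 'x \<Rightarrow>\<^sub>C 'a"
    (infixr "\<odot>" 74)
  where "f \<odot> h = Bcontfun (\<lambda>x. apply_bcontfun f x *\<^sub>C apply_bcontfun h x)"

lemma smult_bcontfun_apply [simp]:
  "apply_bcontfun (f \<odot> h) x = apply_bcontfun f x *\<^sub>C apply_bcontfun h x"
proof -
  have "(\<lambda>x. apply_bcontfun f x *\<^sub>C apply_bcontfun h x) \<in> bcontfun"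
  proof (rule bcontfun_normI)
    show "continuous_on UNIV (\<lambda>x. apply_bcontfun f x *\<^sub>C apply_bcontfun h x)"
      by (intro bounded_bilinear.continuous_on[OF bounded_bilinear_scaleC]) simp_all
    show "norm (apply_bcontfun f x *\<^sub>C apply_bcontfun h x) \<le> norm f * norm h" for x
      unfolding norm_scaleC by (intro mult_mono norm_bounded) simp_all
  qed
  then show ?thesis by (simp add: smult_bcontfun_def Bcontfun_inverse)
qed

lemma norm_smult_bcontfun: "norm (f \<odot> h) \<le> norm f * norm h"
  by (rule norm_bound) (simp add: norm_scaleC mult_mono norm_bounded)

lemma bounded_cbilinear_smult_bcontfun:
  "bounded_cbilinear ((\<odot>) :: ('x::topological_space \<Rightarrow>\<^sub>C complex) \<Rightarrow>
    ('x \<Rightarrow>\<^sub>C 'a::complex_normed_vector) \<Rightarrow> 'x \<Rightarrow>\<^sub>C 'a)"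
  unfolding bounded_cbilinear_def
proof (intro conjI allI)
  note s = bounded_bilinear.add_left[OF bounded_bilinear_scaleC]
    bounded_bilinear.add_right[OF bounded_bilinear_scaleC]
    bounded_bilinear.scaleR_left[OF bounded_bilinear_scaleC]
    bounded_bilinear.scaleR_right[OF bounded_bilinear_scaleC]
  show "bounded_bilinear ((\<odot>) :: ('x \<Rightarrow>\<^sub>C complex) \<Rightarrow> ('x \<Rightarrow>\<^sub>C 'a) \<Rightarrow> 'x \<Rightarrow>\<^sub>C 'a)"
    by standard
      (auto intro!: bcontfun_eqI exI[of _ 1] norm_smult_bcontfun simp: s
        simp del: scaleR_conv_of_real)
  fix c and f :: "'x \<Rightarrow>\<^sub>C complex" and h :: "'x \<Rightarrow>\<^sub>C 'a"
  show "c *\<^sub>C f \<odot> h = c *\<^sub>C (f \<odot> h)"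
    by (rule bcontfun_eqI) (simp add: scaleC_scaleC scaleC_complex_def)
  show "f \<odot> c *\<^sub>C h = c *\<^sub>C (f \<odot> h)"
    by (rule bcontfun_eqI) (simp add: scaleC_scaleC mult.commute)
qed

lemma bounded_clinear_const_bcontfun:
  "bounded_clinear (const_bcontfun :: 'a::complex_normed_vector \<Rightarrow> 'x::topological_space \<Rightarrow>\<^sub>C 'a)"
  unfolding bounded_clinear_def
proof
  show "bounded_linear (const_bcontfun :: 'a \<Rightarrow> 'x \<Rightarrow>\<^sub>C 'a)"
    by (rule bounded_linear_intro[where K = 1]) (auto intro!: bcontfun_eqI norm_bound)
qed (auto intro!: bcontfun_eqI)

text \<open>Approximate \<open>f\<close> by \<open>\<Sum>\<^sub>a (p\<^sub>a \<circ> f) a\<close>, for a partition of unity \<open>(p\<^sub>a)\<close> on the compact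
  metric space \<open>f(X)\<close> subordinate to a cover by small balls around the points \<open>a\<close>.\<close>

lemma closure_span_smult_const_bcontfun:
  assumes "compact (UNIV :: 'x::topological_space set)"
  shows "closure (span (range (\<lambda>(p, a). p \<odot> const_bcontfun a)))
    = (UNIV :: ('x \<Rightarrow>\<^sub>C 'a::complex_normed_vector) set)" (is "closure ?S = _")
proof -
  have "\<exists>g\<in>?S. dist g f < e" if e: "0 < e" for f and e
  proof -
    define r where "r = e / 2"
    have r: "0 < r" "r < e" using e by (auto simp: r_def)
    have "compact (range (apply_bcontfun f))"
      using assms by (intro compact_continuous_image) auto
    moreover have "range (apply_bcontfun f) \<subseteq> (\<Union>a. ball a r)"
    proof
      show "y \<in> (\<Union>a. ball a r)" for y by (rule UN_I[of y]) (simp_all add: r)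
    qed
    ultimately obtain C where C: "finite C" "range (apply_bcontfun f) \<subseteq> (\<Union>a\<in>C. ball a r)"
      by (auto elim: compactE_image[of "range (apply_bcontfun f)" UNIV "\<lambda>a. ball a r"])
    \<comment> \<open>Tent functions around the centres, already composed with \<open>f\<close>. The
      balls cover the range, so their sum \<open>s\<close> is positive and normalising gives the
      partition of unity \<open>p\<close>.\<close>
    define w where "w a x = max 0 (r - dist (apply_bcontfun f x) a)" for a x
    define s where "s x = (\<Sum>a\<in>C. w a x)" for x
    define p where "p a x = w a x / s x" for a x
    have w0: "0 \<le> w a x" for a x by (simp add: w_def)
    have s0: "0 < s x" for x
    proof -
      obtain a where a: "a \<in> C" "apply_bcontfun f x \<in> ball a r" using C by blast
      then have "0 < w a x" by (simp add: w_def dist_commute)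
      then show ?thesis unfolding s_def by (intro sum_pos2[of C a] C a w0)
    qed
    have p0: "0 \<le> p a x" for a x by (simp add: p_def w0 s0 less_imp_le)
    have p1: "(\<Sum>a\<in>C. p a x) = 1" for x
      using s0[of x] by (simp add: p_def s_def flip: sum_divide_distrib)
    have cont: "continuous_on UNIV (p a)" for a
      unfolding p_def w_def s_def[abs_def]
      by (intro continuous_intros continuous_on_max) (use s0 in \<open>auto simp: s_def w_def less_le\<close>)
    define q where "q a = Bcontfun (\<lambda>x. complex_of_real (p a x))" for a
    have q: "apply_bcontfun (q a) x = complex_of_real (p a x)" if "a \<in> C" for a x
    proof -
      have "(\<lambda>x. complex_of_real (p a x)) \<in> bcontfun"
      proof (rule bcontfun_normI)
        show "continuous_on UNIV (\<lambda>x. complex_of_real (p a x))"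
          by (intro continuous_intros cont)
        show "norm (complex_of_real (p a x)) \<le> 1" for x
          using member_le_sum[OF that, of "\<lambda>a. p a x"] C(1) p0 p1[of x] by simp
      qed
      then show ?thesis by (simp add: q_def Bcontfun_inverse)
    qed
    define g where "g = (\<Sum>a\<in>C. q a \<odot> const_bcontfun a)"
    have sum_app: "apply_bcontfun (\<Sum>a\<in>C'. G a) x = (\<Sum>a\<in>C'. apply_bcontfun (G a) x)"
      if "finite C'" for C' x and G :: "'a \<Rightarrow> 'x \<Rightarrow>\<^sub>C 'a"
      using that by induction auto
    have g: "apply_bcontfun g x = (\<Sum>a\<in>C. p a x *\<^sub>R a)" for x
      using C(1) by (simp add: g_def sum_app q scaleC_of_real)
    have "dist g f \<le> r"
    proof (rule dist_bound)
      fix x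
      have "apply_bcontfun g x - apply_bcontfun f x
          = (\<Sum>a\<in>C. p a x *\<^sub>R a) - (\<Sum>a\<in>C. p a x) *\<^sub>R apply_bcontfun f x"
        by (simp add: g p1)
      also have "\<dots> = (\<Sum>a\<in>C. p a x *\<^sub>R (a - apply_bcontfun f x))"
        by (simp add: scaleR_sum_left sum_subtractf scaleR_diff_right)
      also have "norm \<dots> \<le> (\<Sum>a\<in>C. p a x * r)"
      proof (rule sum_norm_le)
        fix a
        \<comment> \<open>Where \<open>f x\<close> is farther than \<open>r\<close> from
          \<open>a\<close>, the weight is zero.\<close>
        show "norm (p a x *\<^sub>R (a - apply_bcontfun f x)) \<le> p a x * r"
        proof (cases "norm (a - apply_bcontfun f x) \<le> r")
          case True
          then show ?thesis using p0 by (simp add: mult_left_mono)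
        next
          case False
          then have "p a x = 0" by (simp add: p_def w_def dist_norm norm_minus_commute)
          then show ?thesis by simp
        qed
      qed
      also have "\<dots> = r" by (simp add: p1 flip: sum_distrib_right)
      finally show "dist (apply_bcontfun g x) (apply_bcontfun f x) \<le> r" by (simp add: dist_norm)
    qed
    moreover have "g \<in> ?S"
      unfolding g_def by (intro span_sum span_base) auto
    ultimately show ?thesis using r by force
  qed
  then show ?thesis by (auto simp: closure_approachable)
qed

text \<open>The kernel of \<open>\<phi>\<close> is a closed subspace containing a set with dense
  span.\<close>

lemma functional_eq_0_if_smult_const_bcontfun:
  fixes \<phi> :: "('x::topological_space \<Rightarrow>\<^sub>C 'a::complex_normed_vector) \<Rightarrow> complex"
  assumes "compact (UNIV :: 'x set)" and \<phi>: "bounded_clinear \<phi>"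
    and 0: "\<And>p a. \<phi> (p \<odot> const_bcontfun a) = 0"
  shows "\<phi> f = 0"
proof -
  interpret bounded_linear \<phi> using \<phi> by (simp add: bounded_clinear_def)
  have "subspace {g. \<phi> g = 0}" by (auto simp: subspace_def add scaleR)
  then have "span (range (\<lambda>(p, a). p \<odot> const_bcontfun a)) \<subseteq> {g. \<phi> g = 0}"
    by (rule span_minimal[rotated]) (auto simp: 0)
  moreover have "closed {g. \<phi> g = 0}"
    by (intro closed_Collect_eq continuous_intros continuous_on continuous_on_id)
  ultimately show ?thesis
    using closure_minimal closure_span_smult_const_bcontfun[OF assms(1), where 'a = 'a] by blast
qed


section \<open>Derivations of the algebra of scalar functions\<close>

text \<open>The Leibniz rule gives T(u^m)(h) = m T(u)(u^(m-1) h). Since u is invertible with powers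
  of norm at most 1 in both directions, h can be chosen with u^(m-1) h = k and |h| \<le> |k|. Then m
  |T(u)(k)| \<le> K |k| for every m \<ge> 1.\<close>

lemma derivation_bcontfun_unimodular:
  fixes T :: "('x::topological_space \<Rightarrow>\<^sub>C complex) \<Rightarrow> ('x \<Rightarrow>\<^sub>C 'a::complex_normed_vector) \<Rightarrow> complex"
  assumes T: "bounded_cbilinear T"
    and der: "\<And>f g h. T (f * g) h = T f (g \<odot> h) + T g (f \<odot> h)"
    and u: "\<And>x. norm (apply_bcontfun u x) = 1"
  shows "T u k = 0"
proof -
  interpret T: bounded_bilinear T using T by (simp add: bounded_cbilinear_def)
  obtain K where K: "0 \<le> K" "\<And>f h. norm (T f h) \<le> norm f * norm h * K"
    using T.nonneg_bounded by blast
  \<comment> \<open>The conjugate is the pointwise inverse of \<open>u\<close>.\<close>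
  define v where "v = Bcontfun (\<lambda>x. cnj (apply_bcontfun u x))"
  have "(\<lambda>x. cnj (apply_bcontfun u x)) \<in> bcontfun"
    by (rule bcontfun_normI[where b = 1]) (auto intro!: continuous_intros simp: u)
  then have v: "apply_bcontfun v x = cnj (apply_bcontfun u x)" for x
    by (simp add: v_def Bcontfun_inverse)
  have nu: "norm u \<le> 1" by (rule norm_bound) (simp add: u)
  have nv: "norm v \<le> 1" by (rule norm_bound) (simp add: u v)
  have uv: "u \<odot> v \<odot> h = h" for h :: "'x \<Rightarrow>\<^sub>C 'a"
  proof (rule bcontfun_eqI)
    fix x
    have "apply_bcontfun u x * apply_bcontfun v x = of_real 1"
      using u[of x] by (simp add: v complex_norm_square[symmetric])
    then show "apply_bcontfun (u \<odot> v \<odot> h) x = apply_bcontfun h x"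
      using scaleC_of_real[of 1] by (simp add: scaleC_scaleC)
  qed
  \<comment> \<open>The exponent of \<open>u\<close> in \<open>U n\<close> is n + 1, so the
    recursion starts at \<open>u\<close> itself and \<open>Suc n\<close> becomes the factor in
    \<open>TU\<close>.\<close>
  define U where "U n = (((*) u) ^^ n) u" for n
  have U: "U 0 = u" "U (Suc n) = u * U n" for n by (simp_all add: U_def)
  have nU: "norm (U n) \<le> 1" for n
  proof (induction n)
    case (Suc n)
    then show ?case
      using norm_mult_ineq[of u "U n"] mult_mono[OF nu Suc] by (simp add: U)
  qed (simp add: U nu)
  have comm: "(((\<odot>) u) ^^ n) (u \<odot> h) = u \<odot> (((\<odot>) u) ^^ n) h" for n and h :: "'x \<Rightarrow>\<^sub>C 'a"
    by (induction n) auto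
  have U_h: "U n \<odot> h = u \<odot> (((\<odot>) u) ^^ n) h" for n and h :: "'x \<Rightarrow>\<^sub>C 'a"
  proof (induction n)
    case (Suc n)
    have "U (Suc n) \<odot> h = u \<odot> U n \<odot> h"
      by (rule bcontfun_eqI) (simp add: U scaleC_scaleC)
    then show ?case by (simp add: Suc)
  qed (simp add: U)
  have TU: "T (U n) h = of_nat (Suc n) * T u ((((\<odot>) u) ^^ n) h)" for n h
  proof (induction n arbitrary: h)
    case (Suc n)
    show ?case
      by (simp add: U der Suc U_h comm algebra_simps)
  qed (simp add: U)
  have bound: "real (Suc n) * norm (T u k) \<le> K * norm k" for n
  proof -
    \<comment> \<open>The preimage of \<open>k\<close> under n-fold multiplication by
      \<open>u\<close>.\<close>
    define h where "h = (((\<odot>) v) ^^ n) k"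
    have "(((\<odot>) u) ^^ n) ((((\<odot>) v) ^^ n) k) = k"
    proof (induction n)
      case (Suc n)
      have "(((\<odot>) u) ^^ Suc n) ((((\<odot>) v) ^^ Suc n) k)
          = (((\<odot>) u) ^^ n) (u \<odot> v \<odot> (((\<odot>) v) ^^ n) k)"
        by (simp add: comm)
      then show ?case by (simp only: uv Suc)
    qed simp
    then have "norm (T (U n) h) = real (Suc n) * norm (T u k)"
      by (simp add: TU h_def norm_mult del: of_nat_Suc)
    moreover have "norm h \<le> norm k"
      unfolding h_def
    proof (induction n)
      case (Suc n)
      have "norm (v \<odot> (((\<odot>) v) ^^ n) k) \<le> 1 * norm k"
        by (rule order_trans[OF norm_smult_bcontfun mult_mono[OF nv Suc]]) auto
      then show ?case by simp
    qed simp
    moreover have "norm (T (U n) h) \<le> 1 * norm k * K"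
      by (rule order_trans[OF K(2)]) (intro mult_mono nU \<open>norm h \<le> norm k\<close> K(1), auto simp: K(1))
    ultimately show ?thesis by (simp add: mult.commute)
  qed
  show ?thesis
  proof (rule ccontr)
    assume "T u k \<noteq> 0"
    then obtain n where "K * norm k < real n * norm (T u k)"
      using reals_Archimedean3[of "norm (T u k)"] by auto
    then show False using bound[of n] norm_ge_zero[of "T u k"]
      unfolding of_nat_Suc distrib_right by linarith
  qed
qed

text \<open>A real function t with |t| \<le> 1 is the mean of the unimodular functions t
  \<plusminus> i sqrt(1 - t^2). Scaling by the norm and splitting into real and imaginary parts
  reduce every function to this case.\<close>

lemma derivation_bcontfun_eq_0:
  fixes T :: "('x::topological_space \<Rightarrow>\<^sub>C complex) \<Rightarrow> ('x \<Rightarrow>\<^sub>C 'a::complex_normed_vector) \<Rightarrow> complex"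
  assumes T: "bounded_cbilinear T"
    and der: "\<And>f g h. T (f * g) h = T f (g \<odot> h) + T g (f \<odot> h)"
  shows "T f h = 0"
proof -
  interpret T: bounded_bilinear T using T by (simp add: bounded_cbilinear_def)
  have TC: "T (c *\<^sub>C f) h = c * T f h" for c f h
    using T by (simp add: bounded_cbilinear_def scaleC_complex_def)
  have small: "T f h = 0"
    if f: "\<And>x. apply_bcontfun f x = of_real (t x)" "\<And>x. \<bar>t x\<bar> \<le> 1" for f t
  proof -
    have t: "continuous_on UNIV t"
      using continuous_on_Re[OF continuous_on_apply_bcontfun[of UNIV f]] by (simp add: f(1))
    have sq: "(t x)\<^sup>2 + (sqrt (1 - (t x)\<^sup>2))\<^sup>2 = 1" for x
      using f(2)[of x] by (simp add: abs_square_le_1)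
    \<comment> \<open>The parameter \<open>s\<close> is the sign, 1 or -1, so both functions are
      handled together.\<close>
    define u where "u s = Bcontfun (\<lambda>x. Complex (t x) (s * sqrt (1 - (t x)\<^sup>2)))" for s
    have u: "apply_bcontfun (u s) x = Complex (t x) (s * sqrt (1 - (t x)\<^sup>2))"
      and nu: "norm (apply_bcontfun (u s) x) = 1" if s: "s\<^sup>2 = 1" for s x
    proof -
      have n: "norm (Complex (t x) (s * sqrt (1 - (t x)\<^sup>2))) = 1" for x
        using sq[of x] s by (simp add: cmod_def power_mult_distrib)
      have "(\<lambda>x. Complex (t x) (s * sqrt (1 - (t x)\<^sup>2))) \<in> bcontfun"
        by (rule bcontfun_normI[where b = 1])
          (auto simp: n intro!: continuous_intros t)
      then show "apply_bcontfun (u s) x = Complex (t x) (s * sqrt (1 - (t x)\<^sup>2))"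
        by (simp add: u_def Bcontfun_inverse)
      then show "norm (apply_bcontfun (u s) x) = 1" by (simp add: n)
    qed
    have "T (u s) h = 0" if "s\<^sup>2 = 1" for s
      using T der nu[OF that] by (rule derivation_bcontfun_unimodular)
    moreover have "2 *\<^sub>C f = u 1 + u (- 1)"
      by (rule bcontfun_eqI) (simp add: u f(1) complex_eq_iff scaleC_complex_def)
    ultimately have "2 * T f h = 0" by (simp add: T.add_left flip: TC)
    then show ?thesis by simp
  qed
  have real: "T f h = 0" if f: "\<And>x. apply_bcontfun f x = of_real (t x)" for f t
  proof (cases "norm f = 0")
    case False
    have "T (of_real (1 / norm f) *\<^sub>C f) h = 0"
    proof (rule small)
      show "apply_bcontfun (of_real (1 / norm f) *\<^sub>C f) x = of_real (t x / norm f)" for x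
        by (simp add: f scaleC_complex_def)
      show "\<bar>t x / norm f\<bar> \<le> 1" for x
        using False norm_bounded[of f x] by (simp add: f abs_divide divide_le_eq_1)
    qed
    then show ?thesis using False by (simp add: TC)
  qed (simp add: T.zero_left)
  define p where "p = Bcontfun (\<lambda>x. complex_of_real (Re (apply_bcontfun f x)))"
  define q where "q = Bcontfun (\<lambda>x. complex_of_real (Im (apply_bcontfun f x)))"
  have "(\<lambda>x. complex_of_real (Re (apply_bcontfun f x))) \<in> bcontfun"
    by (rule bcontfun_normI[where b = "norm f"])
      (auto intro!: continuous_intros order_trans[OF abs_Re_le_cmod norm_bounded])
  then have p: "apply_bcontfun p x = of_real (Re (apply_bcontfun f x))" for x
    by (simp add: p_def Bcontfun_inverse)
  have "(\<lambda>x. complex_of_real (Im (apply_bcontfun f x))) \<in> bcontfun"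
    by (rule bcontfun_normI[where b = "norm f"])
      (auto intro!: continuous_intros order_trans[OF abs_Im_le_cmod norm_bounded])
  then have q: "apply_bcontfun q x = of_real (Im (apply_bcontfun f x))" for x
    by (simp add: q_def Bcontfun_inverse)
  have "f = p + \<i> *\<^sub>C q"
    by (rule bcontfun_eqI) (simp add: p q complex_eq_iff scaleC_complex_def)
  then have "T f h = T p h + \<i> * T q h" by (simp only: T.add_left TC)
  then show ?thesis by (simp add: real[OF p] real[OF q])
qed


section \<open>Weak amenability of the algebra of continuous functions\<close>

theorem theorem3p9:
  fixes \<sigma> :: "'a::{complex_banach_algebra, comm_ring} \<Rightarrow> 'a"
  assumes "compact (UNIV :: 'x::t2_space set)"
    and "continuous_algebra_hom \<sigma>"
    and "closure (range \<sigma>) = UNIV"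
    and "weakly_amenable \<sigma>"
  shows "weakly_amenable (comp_bcontfun \<sigma> :: ('x \<Rightarrow>\<^sub>C 'a) \<Rightarrow> ('x \<Rightarrow>\<^sub>C 'a))"
  unfolding weakly_amenable_def
proof (intro allI impI)
  fix D :: "('x \<Rightarrow>\<^sub>C 'a) \<Rightarrow> ('x \<Rightarrow>\<^sub>C 'a) cdual"
  assume "cdual.derivation (comp_bcontfun \<sigma>) D"
  then have D: "bounded_clinear D"
    and D_mult: "\<And>f g. D (f * g) = cdual_ract (D f) (comp_bcontfun \<sigma> g)
      + cdual_lact (comp_bcontfun \<sigma> f) (D g)"
    by (auto simp: cdual.derivation_def)
  note wa = \<open>weakly_amenable \<sigma>\<close>
  note \<sigma>_ap = comp_bcontfun_apply[OF assms(2)]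
  have \<sigma>_C: "\<sigma> (c *\<^sub>C a) = c *\<^sub>C \<sigma> a" for c a
    using assms(2) by (auto simp: continuous_algebra_hom_def bounded_clinear_def)
  let ?c = "const_bcontfun :: 'a \<Rightarrow> 'x \<Rightarrow>\<^sub>C 'a"
  define F where "F f h = cdual_apply (D f) h" for f h
  have F: "bounded_cbilinear F"
    unfolding F_def
    by (rule bounded_cbilinear_comp[OF bounded_cbilinear_cdual_apply D bounded_clinear_ident])
  \<comment> \<open>Commutativity puts both twisted factors on the same side of
    \<open>h\<close>.\<close>
  have F_mult: "F (f * g) h = F f (comp_bcontfun \<sigma> g * h) + F g (comp_bcontfun \<sigma> f * h)" for f g h
  proof -
    have "h * comp_bcontfun \<sigma> f = comp_bcontfun \<sigma> f * h"
      by (rule bcontfun_eqI) (simp add: mult.commute)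
    then show ?thesis
      by (simp add: F_def D_mult cdual_apply_simps cdual_lact_apply cdual_ract_apply)
  qed
  \<comment> \<open>The twist acts only on values in the algebra; by complex linearity of
    \<open>\<sigma>\<close> the scalar function passes through unchanged.\<close>
  have \<sigma>_smult: "comp_bcontfun \<sigma> (p \<odot> ?c a) * h = ?c (\<sigma> a) * p \<odot> h" for p a h
    by (rule bcontfun_eqI) (simp add: \<sigma>_ap \<sigma>_C mult_scaleC_left mult_scaleC_right)
  have smult_mult: "(p \<odot> ?c a) * (q \<odot> ?c b) = (p * q) \<odot> ?c (a * b)" for p q a b
    by (rule bcontfun_eqI)
      (simp add: mult_scaleC_left mult_scaleC_right scaleC_scaleC mult.commute[where 'a = complex])
  have smult_const: "(p \<odot> ?c a) * ?c b = p \<odot> ?c (a * b)" for p a b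
    by (rule bcontfun_eqI) (simp add: mult_scaleC_left)
  have \<sigma>_const: "comp_bcontfun \<sigma> (?c a) = ?c (\<sigma> a)" for a
    by (rule bcontfun_eqI) (simp add: \<sigma>_ap)
  have c_mult: "?c (a * b) = ?c a * ?c b" for a b
    by (rule bcontfun_eqI) simp

  have F_const_mult: "F (?c a) (h * ?c b) = 0" for a b h
  proof (rule weakly_amenable_bilinear_eq_0[OF wa])
    show "bounded_cbilinear (\<lambda>a b. F (?c a) (h * ?c b))"
      by (intro bounded_cbilinear_comp[OF F] bounded_clinear_const_bcontfun
          bounded_clinear_compose[OF bounded_cbilinear_right[OF bounded_cbilinear_mult]])
    show "F (?c (a * b)) (h * ?c c) = F (?c a) (h * ?c (\<sigma> b * c)) + F (?c b) (h * ?c (\<sigma> a * c))"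
      for a b c
    proof -
      have "?c (\<sigma> a) * (h * ?c c) = h * ?c (\<sigma> a * c)" for a
        by (rule bcontfun_eqI) (simp add: mult.left_commute)
      then show ?thesis by (simp add: c_mult F_mult \<sigma>_const)
    qed
  qed
  have F_const_mult': "F (?c a) (?c b * h) = 0" for a b h
  proof -
    have "?c b * h = h * ?c b"
      by (rule bcontfun_eqI) (simp add: mult.commute)
    then show ?thesis by (simp only: F_const_mult)
  qed
  \<comment> \<open>Removes the constant factor from the second argument: on a product of constants
    the Leibniz rule itself supplies the factors \<open>\<sigma> a\<close> and
    \<open>\<sigma> b\<close>.\<close>
  have F_const: "F (?c a) h = 0" for a h
  proof (rule weakly_amenable_functional_eq_0[OF wa])
    show "bounded_clinear (\<lambda>a. F (?c a) h)"
      by (intro bounded_clinear_compose[OF bounded_cbilinear_left[OF F]]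
          bounded_clinear_const_bcontfun)
    show "F (?c (a * b)) h = 0" for a b
      by (simp add: c_mult F_mult \<sigma>_const F_const_mult')
  qed
  have F_smult_mult: "F (p \<odot> ?c (a * b)) h = F (p \<odot> ?c a) (?c (\<sigma> b) * h)" for p a b h
    by (simp add: F_mult \<sigma>_const F_const flip: smult_const)
  have clin: "bounded_clinear (\<lambda>a. F (p \<odot> ?c a) h)" for p h
    by (intro bounded_clinear_compose[OF bounded_cbilinear_left[OF F]]
        bounded_clinear_compose[OF bounded_cbilinear_right[OF bounded_cbilinear_smult_bcontfun]]
        bounded_clinear_const_bcontfun)
  have F_der: "F ((p * q) \<odot> ?c a) h = F (p \<odot> ?c a) (q \<odot> h) + F (q \<odot> ?c a) (p \<odot> h)" for p q a h
  proof -
    \<comment> \<open>The defect of the desired identity, as a functional of \<open>a\<close>; it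
      suffices that it kills products.\<close>
    let ?\<phi> = "\<lambda>a. F ((p * q) \<odot> ?c a) h - (F (p \<odot> ?c a) (q \<odot> h) + F (q \<odot> ?c a) (p \<odot> h))"
    have "bounded_clinear ?\<phi>"
      using clin[of "p * q" h] clin[of p "q \<odot> h"] clin[of q "p \<odot> h"]
      by (auto simp: bounded_clinear_def scaleC_complex_def algebra_simps
          intro!: bounded_linear_sub bounded_linear_add)
    moreover have "?\<phi> (a * b) = 0" for a b
    proof -
      have "F ((p * q) \<odot> ?c (a * b)) h
          = F (p \<odot> ?c a) (?c (\<sigma> b) * q \<odot> h) + F (q \<odot> ?c b) (?c (\<sigma> a) * p \<odot> h)"
        by (simp add: F_mult \<sigma>_smult flip: smult_mult)
      \<comment> \<open>\<open>F_smult_mult\<close>, read from right to left, absorbs the twisted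
        constants \<open>\<sigma> b\<close> and \<open>\<sigma> a\<close> into the first
        arguments.\<close>
      also have "\<dots> = F (p \<odot> ?c (a * b)) (q \<odot> h) + F (q \<odot> ?c (b * a)) (p \<odot> h)"
        by (simp add: F_smult_mult)
      finally show ?thesis by (simp add: mult.commute)
    qed
    ultimately have "?\<phi> a = 0" by (rule weakly_amenable_functional_eq_0[OF wa])
    then show ?thesis by simp
  qed
  have F_smult: "F (p \<odot> ?c a) h = 0" for p a h
  proof (rule derivation_bcontfun_eq_0)
    show "bounded_cbilinear (\<lambda>p h. F (p \<odot> ?c a) h)"
      by (intro bounded_cbilinear_comp[OF F] bounded_clinear_ident
          bounded_cbilinear_left[OF bounded_cbilinear_smult_bcontfun])
  qed (rule F_der)
  have "F f h = 0" for f h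
    using assms(1) bounded_cbilinear_left[OF F] F_smult
    by (rule functional_eq_0_if_smult_const_bcontfun)
  then have "D f = 0" for f
    by (intro cdual_eqI) (simp add: F_def cdual_apply_simps)
  then show "cdual.inner_derivation (comp_bcontfun \<sigma>) D"
    unfolding cdual.inner_derivation_def
    by (intro exI[of _ 0]) (auto intro!: cdual_eqI
        simp: cdual_apply_simps cdual_lact_apply cdual_ract_apply)
qed

end
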